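(* Let $\mathcal{M}$ be either of the closure operators $\mathcal{A}$ (aggregation closure) or $\mathcal{C}$ (Chvátal–Gomory closure). For every packing polyhedron $Q=\{x\in\mathbb{R}^n_+ \mid Ax\le b\}$, the 1-row closure $1\mathcal{M}(Q)$ is a $2$-approximation of $\mathcal{M}(Q)$. Moreover, this bound is tight: for every $\varepsilon>0$ there is a packing polyhedron $Q$ such that $1\mathcal{M}(Q)$ is not a $(2-\varepsilon)$-approximation of $\mathcal{M}(Q)$.
   Context: A packing polyhedron is a set $Q=\{x\in\mathbb{R}^n_+\mid Ax\le b\}$ with $A\in\mathbb{Q}^{m\times n}$, $b\in\mathbb{Q}^m$ entrywise non-negative; $A^i$ denotes the $i$-th row of $A$. For a polyhedron $Q$, the CG closure is $\mathcal{C}(Q)=\{x\in Q \mid a^\top x\le\lfloor\beta\rfloor \text{ for all } a\in\mathbb{Z}^n,\beta\in\mathbb{R}\text{ with } a^\top x\le\beta\text{ valid for }Q\}$. The aggregation closure (with respect to the given description) is $\mathcal{A}(Q)=\bigcap_{\lambda\in\mathbb{R}^m_+}\operatorname{conv}(\{x\in\mathbb{Z}^n_+\mid \lambda^\top Ax\le\lambda^\top b\})$. The 1-row closures are $1\mathcal{C}(Q)=\bigcap_{i=1}^m\mathcal{C}(\{x\in\mathbb{R}^n_+\mid A^ix\le b_i\})$ and $1\mathcal{A}(Q)=\bigcap_{i=1}^m\mathcal{A}(\{x\in\mathbb{R}^n_+\mid A^ix\le b_i\})$. For sets $U\supseteq V$ of this packing type, $U$ is an $\alpha$-approximation of $V$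 if $\max\{c^\top x\mid x\in U\}\le\alpha\cdot\max\{c^\top x\mid x\in V\}$ for all $c\in\mathbb{R}^n_+$ (maxima are read as suprema in $[0,+\infty]$). *)

theory Defs
  imports
    "Jordan_Normal_Form.Matrix"
    "HOL-Library.Extended_Real"
begin

definition nonneg_orthant :: "nat \<Rightarrow> real vec set" where
  "nonneg_orthant n = {x \<in> carrier_vec n. 0\<^sub>v n \<le> x}"

definition integral_vecs :: "nat \<Rightarrow> real vec set" where
  "integral_vecs n = {x \<in> carrier_vec n. \<forall>j<n. x $ j \<in> \<int>}"

(* The library's convex hull needs the class real_vector, which vectors with a
   dimension given by a term cannot instantiate. *)
definition conv :: "nat \<Rightarrow> real vec set \<Rightarrow> real vec set" where
  "conv n S = {x. \<exists>F w. finite F \<and> F \<subseteq> S \<and> (\<forall>v\<in>F. 0 \<le> w v) \<and> (\<Sum>v\<in>F. w v) = 1 \<and>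
     x = vec n (\<lambda>j. \<Sum>v\<in>F. w v * v $ j)}"

definition packing_data :: "nat \<Rightarrow> nat \<Rightarrow> real mat \<Rightarrow> real vec \<Rightarrow> bool" where
  "packing_data m n A b \<longleftrightarrow>
     A \<in> carrier_mat m n \<and> b \<in> carrier_vec m \<and>
     (\<forall>i<m. \<forall>j<n. A $$ (i, j) \<in> \<rat> \<and> 0 \<le> A $$ (i, j)) \<and>
     (\<forall>i<m. b $ i \<in> \<rat> \<and> 0 \<le> b $ i)"

definition packing_polyhedron :: "real mat \<Rightarrow> real vec \<Rightarrow> real vec set" where
  "packing_polyhedron A b = {x \<in> nonneg_orthant (dim_col A). A *\<^sub>v x \<le> b}"

definition cg_closure :: "nat \<Rightarrow> real vec set \<Rightarrow> real vec set" where
  "cg_closure n Q = {x \<in> Q. \<forall>a \<in> integral_vecs n. \<forall>\<beta>::real.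
     (\<forall>y\<in>Q. a \<bullet> y \<le> \<beta>) \<longrightarrow> a \<bullet> x \<le> of_int \<lfloor>\<beta>\<rfloor>}"

definition chvatal_gomory_closure :: "real mat \<Rightarrow> real vec \<Rightarrow> real vec set" where
  "chvatal_gomory_closure A b = cg_closure (dim_col A) (packing_polyhedron A b)"

definition aggregation_closure :: "real mat \<Rightarrow> real vec \<Rightarrow> real vec set" where
  "aggregation_closure A b =
     (\<Inter>l \<in> nonneg_orthant (dim_row A).
        conv (dim_col A)
          {x \<in> nonneg_orthant (dim_col A) \<inter> integral_vecs (dim_col A).
             l \<bullet> (A *\<^sub>v x) \<le> l \<bullet> b})"

(* For a system without rows the intersection is taken inside the non-negative orthant. *)
definition one_row_closure ::
  "(real mat \<Rightarrow> real vec \<Rightarrow> real vec set) \<Rightarrow> real mat \<Rightarrow> real vec \<Rightarrow> real vec set" where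
  "one_row_closure M A b =
     {x \<in> nonneg_orthant (dim_col A). \<forall>i < dim_row A.
        x \<in> M (mat_of_rows (dim_col A) [row A i]) (vec_of_list [b $ i])}"

(* The sets compared below contain the origin, so both suprema lie in [0, \<infinity>]. *)
definition is_approximation ::
  "nat \<Rightarrow> real \<Rightarrow> real vec set \<Rightarrow> real vec set \<Rightarrow> bool" where
  "is_approximation n \<alpha> U V \<longleftrightarrow>
     (\<forall>c \<in> nonneg_orthant n.
        (SUP x\<in>U. ereal (c \<bullet> x)) \<le> ereal \<alpha> * (SUP x\<in>V. ereal (c \<bullet> x)))"

end

theory Submission
  imports Defs
begin

text \<open>Every \<open>x\<close> in the one-row closure satisfies \<open>A x \<le> b\<close>, and \<open>x\<^sub>j = 0\<close> whenever
  \<open>A\<^sub>i\<^sub>j > b\<^sub>i\<close> for some row \<open>i\<close>. For such a point, \<open>x/2\<close> lies in the closure itself. In an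
  aggregated knapsack \<open>a y \<le> \<beta>\<close> each relevant item fits, and rounding \<open>\<beta>/a\<^sub>j \<ge> 1\<close> down loses less
  than a factor 2, so half the linear relaxation is contained in the integer hull. For a valid
  inequality \<open>a y \<le> \<beta>\<close> with \<open>a\<close> integral, either some unit vector in the support of \<open>x\<close> forces
  \<open>\<beta> \<ge> 1\<close> and hence \<open>\<beta> < 2 \<lfloor>\<beta>\<rfloor>\<close>, or \<open>a x \<le> 0\<close>. Tightness is witnessed by
  \<open>x\<^sub>0 + x\<^sub>1/k \<le> 1\<close>, \<open>x\<^sub>0/k + x\<^sub>1 \<le> 1\<close>: each row alone defines an integral polyhedron, so the one-row
  closures contain \<open>k/(k+1) (1, 1)\<close>.\<close>

section \<open>Coordinates and scalar products\<close>

declare vec_of_list_Cons [simp del]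

lemma vec_of_list_singleton [simp]: "vec_of_list [c] $ 0 = c"
  by (simp add: vec_of_list_Cons)

lemma nonneg_orthant_iff:
  "x \<in> nonneg_orthant n \<longleftrightarrow> x \<in> carrier_vec n \<and> (\<forall>j<n. 0 \<le> x $ j)"
  by (auto simp: nonneg_orthant_def less_eq_vec_def)

lemma scalar_prod_sum:
  "x \<in> carrier_vec n \<Longrightarrow> a \<bullet> x = (\<Sum>j<n. a $ j * x $ j)"
  by (auto simp: scalar_prod_def atLeast0LessThan)

lemma scalar_prod_mono:
  fixes x y l :: "real vec"
  assumes "l \<in> nonneg_orthant n" "x \<le> y" "y \<in> carrier_vec n"
  shows "l \<bullet> x \<le> l \<bullet> y"
proof -
  have y: "dim_vec y = n" and le: "dim_vec x = dim_vec y" "\<And>j. j < dim_vec y \<Longrightarrow> x $ j \<le> y $ j"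
    using assms(2) carrier_vecD[OF assms(3)] unfolding less_eq_vec_def by auto
  then have x: "x \<in> carrier_vec n" by (intro carrier_vecI) simp
  show ?thesis
    unfolding scalar_prod_sum[OF x] scalar_prod_sum[OF assms(3)]
    using assms(1) le y by (intro sum_mono mult_left_mono) (simp_all add: nonneg_orthant_iff)
qed

section \<open>Convex hulls\<close>

lemma conv_mono: "S \<subseteq> T \<Longrightarrow> conv n S \<subseteq> conv n T"
  unfolding conv_def by blast

lemma conv_carrier: "x \<in> conv n S \<Longrightarrow> x \<in> carrier_vec n"
  by (auto simp: conv_def)

lemma conv_scalar_prod_le:
  assumes x: "x \<in> conv n S" and S: "S \<subseteq> carrier_vec n"
    and le: "\<And>v. v \<in> S \<Longrightarrow> a \<bullet> v \<le> \<beta>"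
  shows "a \<bullet> x \<le> \<beta>"
proof -
  from x obtain F w where F: "finite F" "F \<subseteq> S" "\<forall>v\<in>F. 0 \<le> w v" "(\<Sum>v\<in>F. w v) = 1"
    and xe: "x = vec n (\<lambda>j. \<Sum>v\<in>F. w v * v $ j)"
    by (auto simp: conv_def)
  have "a \<bullet> x = (\<Sum>j<n. a $ j * (\<Sum>v\<in>F. w v * v $ j))"
    unfolding scalar_prod_sum[OF conv_carrier[OF x]] by (simp add: xe)
  also have "\<dots> = (\<Sum>v\<in>F. w v * (\<Sum>j<n. a $ j * v $ j))"
    by (simp add: sum_distrib_left sum.swap[of _ F] algebra_simps)
  also have "\<dots> = (\<Sum>v\<in>F. w v * (a \<bullet> v))"
    using F(2) S by (intro sum.cong refl) (subst scalar_prod_sum[of _ n], auto)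
  also have "\<dots> \<le> (\<Sum>v\<in>F. w v * \<beta>)"
    using F le by (intro sum_mono mult_left_mono) auto
  also have "\<dots> = \<beta>"
    using F by (simp flip: sum_distrib_right)
  finally show ?thesis .
qed

lemma conv_nonneg:
  assumes x: "x \<in> conv n S" and S: "S \<subseteq> nonneg_orthant n"
  shows "x \<in> nonneg_orthant n"
proof -
  have "0 \<le> x $ j" if "j < n" for j
    using assms that by (auto simp: conv_def nonneg_orthant_iff subset_iff intro!: sum_nonneg)
  then show ?thesis
    using conv_carrier[OF x] by (simp add: nonneg_orthant_iff)
qed

text \<open>\<open>conv\<close> attaches weights to points, so an indexed family with repetitions
  does not fit it directly. The weights of all indices with the same point are collected in
  \<open>u\<close>.\<close>

lemma conv_indexed:
  assumes I: "finite I" and f: "\<And>i. i \<in> I \<Longrightarrow> f i \<in> S"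
    and w: "\<And>i. i \<in> I \<Longrightarrow> 0 \<le> w i" "(\<Sum>i\<in>I. w i) = 1"
  shows "vec n (\<lambda>j. \<Sum>i\<in>I. w i * f i $ j) \<in> conv n S"
proof -
  define u where "u v = (\<Sum>i\<in>{i\<in>I. f i = v}. w i)" for v
  have s1: "(\<Sum>v\<in>f ` I. u v) = 1"
    unfolding u_def using sum.image_gen[OF I, of w f] w by simp
  have s2: "(\<Sum>i\<in>I. w i * f i $ j) = (\<Sum>v\<in>f ` I. u v * v $ j)" for j
    unfolding u_def sum.image_gen[OF I, of _ f] sum_distrib_right
    by (intro sum.cong refl) auto
  show ?thesis
    unfolding conv_def mem_Collect_eq s2
    by (intro exI[of _ "f ` I"] exI[of _ u] conjI refl)
      (use I f w s1 in \<open>auto simp: u_def intro!: sum_nonneg\<close>)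
qed

text \<open>The weight left over from the axis points goes to the origin, which is given the extra
  index \<open>n\<close>. Both the factor 2 for knapsacks and the tight example build their convex
  combinations this way.\<close>

lemma conv_axis_points:
  fixes K :: "nat \<Rightarrow> real"
  assumes 0: "0\<^sub>v n \<in> S" and K: "\<And>j. j < n \<Longrightarrow> K j \<cdot>\<^sub>v unit_vec n j \<in> S"
    and w: "\<And>j. j < n \<Longrightarrow> 0 \<le> w j" "(\<Sum>j<n. w j) \<le> 1"
  shows "vec n (\<lambda>j. w j * K j) \<in> conv n S"
proof -
  let ?f = "\<lambda>i. if i < n then K i \<cdot>\<^sub>v unit_vec n i else 0\<^sub>v n"
  let ?w = "\<lambda>i. if i < n then w i else 1 - (\<Sum>j<n. w j)"
  have "vec n (\<lambda>j. \<Sum>i\<in>{..<Suc n}. ?w i * ?f i $ j) \<in> conv n S"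
    by (rule conv_indexed) (use assms in auto)
  moreover have "(\<Sum>i\<in>{..<Suc n}. ?w i * ?f i $ j) = w j * K j" if "j < n" for j
  proof -
    have "(\<Sum>i\<in>{..<Suc n}. ?w i * ?f i $ j) = (\<Sum>i<n. ?w i * ?f i $ j)"
      using that by simp
    also have "\<dots> = (\<Sum>i<n. if i = j then w j * K j else 0)"
      using that by (intro sum.cong refl) (auto simp: unit_vec_def)
    finally show ?thesis using that by simp
  qed
  ultimately show ?thesis
    by (metis (no_types, lifting) eq_vecI dim_vec index_vec)
qed

section \<open>Half of the linear relaxation lies in the closures\<close>

text \<open>This is the source of the factor 2: \<open>t\<close> is less than its floor plus 1, and
  the floor is at least 1. The strictness is used later to create slack.\<close>

lemma less_twice_floor:
  fixes t :: real
  assumes "1 \<le> t"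
  shows "t < 2 * of_int \<lfloor>t\<rfloor>"
proof -
  have "1 \<le> \<lfloor>t\<rfloor>" using assms by simp
  then have "(1::real) \<le> of_int \<lfloor>t\<rfloor>" by linarith
  then show ?thesis by linarith
qed

text \<open>The point \<open>x\<close>/2 is written as a combination of multiples \<open>K j\<close>
  of the unit vectors with weights \<open>x $ j / (2 * K j)\<close>. For an item of positive size,
  \<open>K j\<close> is the largest number of copies that fits. An item of size 0 admits any number
  of copies, so its weight can be made as small as desired.\<close>

lemma half_mem_knapsack_hull:
  fixes a :: "real vec"
  assumes a: "a \<in> nonneg_orthant n" and x: "x \<in> nonneg_orthant n"
    and le: "a \<bullet> x \<le> \<beta>" and fits: "\<And>j. j < n \<Longrightarrow> x $ j \<noteq> 0 \<Longrightarrow> a $ j \<le> \<beta>" and "0 \<le> \<beta>"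
  shows "(1/2) \<cdot>\<^sub>v x \<in> conv n {y \<in> nonneg_orthant n \<inter> integral_vecs n. a \<bullet> y \<le> \<beta>}"
    (is "_ \<in> conv n ?S")
proof -
  have a0: "0 \<le> a $ j" if "j < n" for j using a that by (simp add: nonneg_orthant_iff)
  have x0: "0 \<le> x $ j" if "j < n" for j using x that by (simp add: nonneg_orthant_iff)
  have ac: "a \<in> carrier_vec n" and xc: "x \<in> carrier_vec n"
    using a x by (auto simp: nonneg_orthant_iff)
  define P where "P = {j\<in>{..<n}. x $ j \<noteq> 0 \<and> a $ j \<noteq> 0}"
  define L where "L j = (of_int \<lfloor>\<beta> / a $ j\<rfloor> :: real)" for j
  \<comment> \<open>The strict bound on the floors leaves positive slack \<open>s\<close>, which pays for the items of size 0.\<close>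
  define s where "s = 1 - (\<Sum>j\<in>P. x $ j / (2 * L j))"
  have P: "finite P" "\<And>j. j \<in> P \<Longrightarrow> j < n \<and> 0 < x $ j \<and> 0 < a $ j"
    using a0 x0 by (force simp: P_def)+
  have Lpos: "0 < L j" "x $ j / (2 * L j) < a $ j * x $ j / \<beta>" "L j * a $ j \<le> \<beta>" "0 < \<beta>"
    if "j \<in> P" for j
  proof -
    have aj: "0 < a $ j" "a $ j \<le> \<beta>" "0 < x $ j" using P(2)[OF that] fits by force+
    then have t: "1 \<le> \<beta> / a $ j" and b: "0 < \<beta>" by (auto simp: field_simps)
    have "\<beta> / a $ j < 2 * L j" using less_twice_floor[OF t] by (simp add: L_def)
    then have l: "\<beta> < 2 * L j * a $ j" using aj by (simp add: field_simps)
    show "0 < \<beta>" by (fact b)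
    show L: "0 < L j" using t \<open>\<beta> / a $ j < 2 * L j\<close> by linarith
    have "\<beta> * x $ j < 2 * L j * a $ j * x $ j" using l aj by simp
    then show "x $ j / (2 * L j) < a $ j * x $ j / \<beta>"
      using b L by (simp add: field_simps)
    have "L j \<le> \<beta> / a $ j" by (simp add: L_def)
    then show "L j * a $ j \<le> \<beta>" using aj by (simp add: field_simps)
  qed
  have "0 < s"
  \<comment> \<open>The strict comparison of sums requires a nonempty index set, which also provides
    \<beta> > 0 for the division.\<close>
  proof (cases "P = {}")
    case True
    then show ?thesis by (simp add: s_def)
  next
    case False
    then have b: "0 < \<beta>" using Lpos by auto
    have "(\<Sum>j\<in>P. x $ j / (2 * L j)) < (\<Sum>j\<in>P. a $ j * x $ j / \<beta>)"
      using False P Lpos by (intro sum_strict_mono) auto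
    also have "\<dots> \<le> (\<Sum>j<n. a $ j * x $ j / \<beta>)"
      using a0 x0 b by (intro sum_mono2) (auto simp: P_def)
    also have "\<dots> = a \<bullet> x / \<beta>"
      by (simp add: scalar_prod_sum[OF xc] sum_divide_distrib)
    also have "\<dots> \<le> 1" using le b by simp
    finally show ?thesis by (simp add: s_def)
  qed
  \<comment> \<open>Chosen so large that each item of size 0 costs weight at most
    \<open>s / n\<close>, hence all of them together at most \<open>s\<close>. The added 1 keeps
    \<open>Z j\<close> positive even when \<open>x $ j = 0\<close>.\<close>
  define Z where "Z j = (of_int (\<lceil>real n * x $ j / s\<rceil> + 1) :: real)" for j
  have Z: "0 < Z j" "x $ j / (2 * Z j) \<le> s / n" if "j < n" for j
  proof -
    have h: "real n * x $ j / s \<le> Z j" "0 \<le> real n * x $ j / s"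
      using x0[OF that] \<open>0 < s\<close> unfolding Z_def by (auto intro: order.trans[OF le_of_int_ceiling])
    then have "0 \<le> \<lceil>real n * x $ j / s\<rceil>" by linarith
    then have "1 \<le> \<lceil>real n * x $ j / s\<rceil> + 1" by linarith
    then have "1 \<le> Z j" unfolding Z_def by (metis of_int_1_le_iff)
    then show zp: "0 < Z j" by simp
    have "real n * x $ j \<le> Z j * s" using h \<open>0 < s\<close> by (simp add: field_simps)
    also have "\<dots> \<le> 2 * Z j * s" using zp \<open>0 < s\<close> by simp
    finally show "x $ j / (2 * Z j) \<le> s / n"
      using that zp by (simp add: field_simps)
  qed
  \<comment> \<open>Where \<open>x $ j = 0\<close> the item may exceed \<beta>, so no positive
    multiple of the unit vector is available; the value 0 falls back on the origin.\<close>
  define K where "K j = (if x $ j = 0 then 0 else if a $ j = 0 then Z j else L j)" for j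
  define w where "w j = (if x $ j = 0 then 0 else x $ j / (2 * K j))" for j
  have Kpos: "0 < K j" if "j < n" "x $ j \<noteq> 0" for j
    using Z[of j] Lpos[of j] that by (auto simp: K_def P_def)
  have K0: "0 \<le> K j" "K j \<in> \<int>" "a $ j * K j \<le> \<beta>" if "j < n" for j
  proof -
    show "0 \<le> K j" using Kpos[OF that] by (cases "x $ j = 0") (auto simp: K_def)
    show "K j \<in> \<int>" by (simp add: K_def Z_def L_def)
    show "a $ j * K j \<le> \<beta>" using Lpos[of j] that \<open>0 \<le> \<beta>\<close> by (auto simp: K_def P_def mult.commute)
  qed
  have "(\<Sum>j<n. w j) = (\<Sum>j\<in>P. w j) + (\<Sum>j\<in>{..<n}-P. w j)"
    by (rule sum.subset_diff[THEN trans]) (auto simp: P_def add.commute)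
  also have "(\<Sum>j\<in>P. w j) = 1 - s"
    by (auto simp: s_def w_def K_def P_def intro!: sum.cong)
  \<comment> \<open>Outside \<open>P\<close> an index has either weight 0 or an item of size 0,
    whose weight was bounded through \<open>Z\<close>.\<close>
  also have "(\<Sum>j\<in>{..<n}-P. w j) \<le> (\<Sum>j\<in>{..<n}-P. s / n)"
    using Z \<open>0 < s\<close> by (intro sum_mono) (auto simp: w_def K_def P_def)
  also have "\<dots> \<le> (\<Sum>j<n. s / n)" using \<open>0 < s\<close> by (intro sum_mono2) auto
  also have "\<dots> \<le> s" using \<open>0 < s\<close> by simp
  finally have wsum: "(\<Sum>j<n. w j) \<le> 1" by simp
  have "vec n (\<lambda>j. w j * K j) \<in> conv n ?S"
  proof (rule conv_axis_points)
    show "0\<^sub>v n \<in> ?S" using ac \<open>0 \<le> \<beta>\<close> by (auto simp: nonneg_orthant_iff integral_vecs_def)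
    show "K j \<cdot>\<^sub>v unit_vec n j \<in> ?S" if "j < n" for j
      using K0[OF that] that ac
      by (auto simp: nonneg_orthant_iff integral_vecs_def unit_vec_def scalar_prod_sum[of _ n] if_distrib cong: if_cong)
    show "0 \<le> w j" if "j < n" for j
      using Kpos[OF that] x0[OF that] by (auto simp: w_def intro!: divide_nonneg_nonneg)
  qed (fact wsum)
  also have "vec n (\<lambda>j. w j * K j) = (1/2) \<cdot>\<^sub>v x"
    using xc Kpos by (intro eq_vecI) (auto simp: w_def field_simps less_imp_neq[symmetric] dest: less_imp_neq)
  finally show ?thesis .
qed

text \<open>Each multiplier \<open>l\<close> gives a knapsack with sizes
  \<open>A\<^sup>T *\<^sub>v l\<close> and capacity \<open>l \<bullet> b\<close>. The entrywise
  bounds in \<open>supp\<close> survive nonnegative aggregation, so every item in the support of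
  \<open>x\<close> fits in it.\<close>

lemma half_mem_aggregation_closure:
  assumes pd: "packing_data m n A b" and x: "x \<in> nonneg_orthant n" and le: "A *\<^sub>v x \<le> b"
    and supp: "\<And>i j. i < m \<Longrightarrow> j < n \<Longrightarrow> x $ j \<noteq> 0 \<Longrightarrow> A $$ (i, j) \<le> b $ i"
  shows "(1/2) \<cdot>\<^sub>v x \<in> aggregation_closure A b"
proof -
  have A: "A \<in> carrier_mat m n" and b: "b \<in> carrier_vec m" "b \<in> nonneg_orthant m"
    and A0: "\<And>i j. i < m \<Longrightarrow> j < n \<Longrightarrow> 0 \<le> A $$ (i, j)"
    using pd by (auto simp: packing_data_def nonneg_orthant_iff)
  have "(1/2) \<cdot>\<^sub>v x \<in> conv n {y \<in> nonneg_orthant n \<inter> integral_vecs n. l \<bullet> (A *\<^sub>v y) \<le> l \<bullet> b}"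
    if l: "l \<in> nonneg_orthant m" for l
  proof -
    let ?a = "A\<^sup>T *\<^sub>v l"
    have lc: "l \<in> carrier_vec m" and l0: "\<And>i. i < m \<Longrightarrow> 0 \<le> l $ i"
      using l by (auto simp: nonneg_orthant_iff)
    have aj: "?a $ j = (\<Sum>i<m. l $ i * A $$ (i, j))" if "j < n" for j
      using that A lc by (auto simp: scalar_prod_sum[of _ m] mult.commute intro!: sum.cong)
    have eq: "?a \<bullet> y = l \<bullet> (A *\<^sub>v y)" if "y \<in> carrier_vec n" for y
      by (rule transpose_vec_mult_scalar[OF A that lc])
    have "(1/2) \<cdot>\<^sub>v x \<in> conv n {y \<in> nonneg_orthant n \<inter> integral_vecs n. ?a \<bullet> y \<le> l \<bullet> b}"
    proof (rule half_mem_knapsack_hull[OF _ x])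
      show "?a \<in> nonneg_orthant n"
        using A A0 l0 aj by (auto simp: nonneg_orthant_iff simp del: index_mult_mat_vec
            intro!: sum_nonneg mult_mat_vec_carrier[of _ _ m] lc)
      show "?a \<bullet> x \<le> l \<bullet> b"
        using x by (subst eq) (auto simp: nonneg_orthant_iff intro: scalar_prod_mono[OF l le b(1)])
      show "?a $ j \<le> l \<bullet> b" if "j < n" "x $ j \<noteq> 0" for j
        unfolding aj[OF that(1)] scalar_prod_sum[OF b(1)]
        using supp that l0 by (auto intro!: sum_mono mult_left_mono)
      show "0 \<le> l \<bullet> b"
        unfolding scalar_prod_sum[OF b(1)] using b l0
        by (auto simp: nonneg_orthant_iff intro!: sum_nonneg)
    qed
    also have "{y \<in> nonneg_orthant n \<inter> integral_vecs n. ?a \<bullet> y \<le> l \<bullet> b} =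
        {y \<in> nonneg_orthant n \<inter> integral_vecs n. l \<bullet> (A *\<^sub>v y) \<le> l \<bullet> b}"
      using eq by (auto simp: nonneg_orthant_iff)
    finally show ?thesis .
  qed
  then show ?thesis using A by (auto simp: aggregation_closure_def)
qed

text \<open>A valid inequality is tested at three kinds of points of the polyhedron: the origin
  gives \<beta> \<ge> 0, a unit vector in the support of \<open>x\<close> with a positive
  coefficient gives \<beta> \<ge> 1, and \<open>x\<close> itself bounds \<open>a \<bullet> x\<close>
  by \<beta>.\<close>

lemma half_mem_cg_closure:
  assumes pd: "packing_data m n A b" and x: "x \<in> nonneg_orthant n" and le: "A *\<^sub>v x \<le> b"
    and supp: "\<And>i j. i < m \<Longrightarrow> j < n \<Longrightarrow> x $ j \<noteq> 0 \<Longrightarrow> A $$ (i, j) \<le> b $ i"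
  shows "(1/2) \<cdot>\<^sub>v x \<in> chvatal_gomory_closure A b"
proof -
  have A: "A \<in> carrier_mat m n" and b: "b \<in> carrier_vec m" and b0: "\<And>i. i < m \<Longrightarrow> 0 \<le> b $ i"
    using pd by (auto simp: packing_data_def)
  have xc: "x \<in> carrier_vec n" using x by (simp add: nonneg_orthant_iff)
  let ?Q = "packing_polyhedron A b"
  have xQ: "x \<in> ?Q" using A x le by (auto simp: packing_polyhedron_def)
  have Ax: "(A *\<^sub>v ((1/2) \<cdot>\<^sub>v x)) $ i \<le> b $ i" if "i < m" for i
  proof -
    have "(A *\<^sub>v x) $ i \<le> b $ i" using le that b by (auto simp: less_eq_vec_def)
    then show ?thesis using A xc b0[OF that] that
      by (simp add: mult_mat_vec[OF A xc])
  qed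
  have hQ: "(1/2) \<cdot>\<^sub>v x \<in> ?Q"
    using A b x Ax by (auto simp: packing_polyhedron_def nonneg_orthant_iff less_eq_vec_def)
  have zQ: "0\<^sub>v n \<in> ?Q"
    using A b b0 by (auto simp: packing_polyhedron_def nonneg_orthant_iff less_eq_vec_def)
  \<comment> \<open>The image of the unit vector is column \<open>j\<close> of \<open>A\<close>,
    which \<open>supp\<close> bounds by \<open>b\<close>.\<close>
  have eQ: "unit_vec n j \<in> ?Q" if "j < n" "x $ j \<noteq> 0" for j
    using A b supp that
    by (auto simp: packing_polyhedron_def nonneg_orthant_iff less_eq_vec_def unit_vec_def mult_mat_vec_def scalar_prod_sum[of _ n] if_distrib cong: if_cong)
  have "a \<bullet> ((1/2) \<cdot>\<^sub>v x) \<le> of_int \<lfloor>\<beta>\<rfloor>"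
    if a: "a \<in> integral_vecs n" and v: "\<forall>y\<in>?Q. a \<bullet> y \<le> \<beta>" for a and \<beta> :: real
  proof -
    have ac: "a \<in> carrier_vec n" using a by (simp add: integral_vecs_def)
    have half: "a \<bullet> ((1/2) \<cdot>\<^sub>v x) = (a \<bullet> x) / 2" using ac xc by simp
    have b0: "0 \<le> \<beta>" using v[rule_format, OF zQ] ac by simp
    show ?thesis
    proof (cases "\<exists>j<n. x $ j \<noteq> 0 \<and> 0 < a $ j")
      case True
      then obtain j where j: "j < n" "x $ j \<noteq> 0" "0 < a $ j" by blast
      have "a $ j \<in> \<int>" using a j by (simp add: integral_vecs_def)
      \<comment> \<open>Integrality of \<open>a\<close> lifts the positive coefficient to at least
        1, and thereby \<beta> as well.\<close>
      then have "1 \<le> a $ j" using j(3) by (elim Ints_cases) simp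
      also have "a $ j \<le> \<beta>" using v[rule_format, OF eQ[OF j(1,2)]] ac j by simp
      finally have "\<beta> < 2 * of_int \<lfloor>\<beta>\<rfloor>" by (rule less_twice_floor)
      then show ?thesis using v[rule_format, OF xQ] half by linarith
    next
      case False
      have "a \<bullet> x \<le> 0"
        unfolding scalar_prod_sum[OF xc]
      proof (rule sum_nonpos)
        fix j assume "j \<in> {..<n}"
        then have "x $ j = 0 \<or> a $ j \<le> 0" "0 \<le> x $ j"
          using False x unfolding nonneg_orthant_iff by (metis lessThan_iff not_less)+
        then show "a $ j * x $ j \<le> 0" by (auto intro: mult_nonpos_nonneg)
      qed
      moreover have "(0::real) \<le> of_int \<lfloor>\<beta>\<rfloor>" using b0 by simp
      ultimately show ?thesis using half by linarith
    qed
  qed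
  then show ?thesis using A hQ by (auto simp: chvatal_gomory_closure_def cg_closure_def)
qed

section \<open>Single-row systems and the inclusion of the closures in their one-row
  versions\<close>

lemma one_row_mult:
  assumes "A \<in> carrier_mat m n"
  shows "mat_of_rows n [row A i] *\<^sub>v x = vec 1 (\<lambda>_. row A i \<bullet> x)"
  using assms by (intro eq_vecI) auto

lemma packing_polyhedron_one_row:
  assumes "A \<in> carrier_mat m n"
  shows "packing_polyhedron (mat_of_rows n [row A i]) (vec_of_list [\<beta>]) =
    {x \<in> nonneg_orthant n. row A i \<bullet> x \<le> \<beta>}"
  by (auto simp: packing_polyhedron_def one_row_mult[OF assms] less_eq_vec_def)

text \<open>With one row a multiplier is a single scalar, its entry at 0, and these entries range
  over all nonnegative reals.\<close>

lemma aggregation_closure_one_row: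
  assumes "A \<in> carrier_mat m n"
  shows "aggregation_closure (mat_of_rows n [row A i]) (vec_of_list [\<beta>]) =
    (\<Inter>t \<in> {0..}. conv n {x \<in> nonneg_orthant n \<inter> integral_vecs n. t * (row A i \<bullet> x) \<le> t * \<beta>})"
    (is "?L = ?R")
proof -
  have 1: "l \<bullet> vec 1 (\<lambda>_. c) = l $ 0 * c" "l \<bullet> vec_of_list [\<beta>] = l $ 0 * \<beta>" for l :: "real vec" and c
    by (auto simp: scalar_prod_def)
  have 2: "(\<lambda>l. l $ 0) ` nonneg_orthant 1 = {0..}"
  proof (intro equalityI subsetI)
    fix t :: real assume "t \<in> {0..}"
    then show "t \<in> (\<lambda>l. l $ 0) ` nonneg_orthant 1"
      by (intro image_eqI[of _ _ "vec 1 (\<lambda>_. t)"]) (auto simp: nonneg_orthant_iff)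
  qed (auto simp: nonneg_orthant_iff)
  have "?L = (\<Inter>l\<in>nonneg_orthant 1. conv n {x \<in> nonneg_orthant n \<inter> integral_vecs n.
      l $ 0 * (row A i \<bullet> x) \<le> l $ 0 * \<beta>})"
    by (simp add: aggregation_closure_def one_row_mult[OF assms] 1[unfolded One_nat_def])
  also have "\<dots> = ?R" unfolding 2[symmetric] by simp
  finally show ?thesis .
qed

text \<open>Scaling row \<open>i\<close> by \<open>t\<close> is aggregation with the multiplier
  \<open>t \<cdot>\<^sub>v unit_vec m i\<close>, so the one-row hulls occur among those intersected
  in the full closure.\<close>

lemma aggregation_closure_subset:
  assumes pd: "packing_data m n A b"
  shows "aggregation_closure A b \<subseteq> one_row_closure aggregation_closure A b"
proof
  fix x assume x: "x \<in> aggregation_closure A b"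
  have A: "A \<in> carrier_mat m n" and b: "b \<in> carrier_vec m"
    using pd by (auto simp: packing_data_def)
  let ?S = "\<lambda>l. {y \<in> nonneg_orthant n \<inter> integral_vecs n. l \<bullet> (A *\<^sub>v y) \<le> l \<bullet> b}"
  have h: "x \<in> conv n (?S l)" if "l \<in> nonneg_orthant m" for l
    using x that A by (auto simp: aggregation_closure_def)
  \<comment> \<open>The zero multiplier exists for every \<open>m\<close>, so this covers a system
    without rows too.\<close>
  have x0: "x \<in> nonneg_orthant n"
    using h[of "0\<^sub>v m"] by (auto simp: nonneg_orthant_iff[of "0\<^sub>v m"] intro: conv_nonneg)
  have "x \<in> conv n {y \<in> nonneg_orthant n \<inter> integral_vecs n. t * (row A i \<bullet> y) \<le> t * b $ i}"
    if "i < m" "0 \<le> t" for i t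
  proof -
    have "x \<in> conv n (?S (t \<cdot>\<^sub>v unit_vec m i))"
      using that by (intro h) (auto simp: nonneg_orthant_iff unit_vec_def)
    also have "?S (t \<cdot>\<^sub>v unit_vec m i) =
        {y \<in> nonneg_orthant n \<inter> integral_vecs n. t * (row A i \<bullet> y) \<le> t * b $ i}"
    proof -
      have "unit_vec m i \<bullet> (A *\<^sub>v y) = row A i \<bullet> y" for y
      proof -
        have "A *\<^sub>v y \<in> carrier_vec m" using A by (intro carrier_vecI) simp
        then show ?thesis using A that by (simp add: scalar_prod_left_unit)
      qed
      then show ?thesis using A b that by auto
    qed
    finally show ?thesis .
  qed
  then show "x \<in> one_row_closure aggregation_closure A b"
    using A x0 by (auto simp: one_row_closure_def aggregation_closure_one_row[OF A])
qed

text \<open>An inequality valid for the larger set is valid for the smaller one.\<close>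

lemma cg_closure_mono:
  assumes "P \<subseteq> Q" shows "cg_closure n P \<subseteq> cg_closure n Q"
  using assms unfolding cg_closure_def by blast

lemma packing_polyhedron_subset_row:
  assumes "A \<in> carrier_mat m n" "b \<in> carrier_vec m" "i < m"
  shows "packing_polyhedron A b \<subseteq> {x \<in> nonneg_orthant n. row A i \<bullet> x \<le> b $ i}"
  using assms by (auto simp: packing_polyhedron_def less_eq_vec_def)

lemma chvatal_gomory_closure_subset:
  assumes pd: "packing_data m n A b"
  shows "chvatal_gomory_closure A b \<subseteq> one_row_closure chvatal_gomory_closure A b"
proof -
  have A: "A \<in> carrier_mat m n" and b: "b \<in> carrier_vec m"
    using pd by (auto simp: packing_data_def)
  have "chvatal_gomory_closure A b \<subseteq> nonneg_orthant n"
    using A by (auto simp: chvatal_gomory_closure_def cg_closure_def packing_polyhedron_def)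
  moreover have "chvatal_gomory_closure A b \<subseteq>
      chvatal_gomory_closure (mat_of_rows n [row A i]) (vec_of_list [b $ i])" if "i < m" for i
    using cg_closure_mono[OF packing_polyhedron_subset_row[OF A b that], of n] A
    by (simp add: chvatal_gomory_closure_def packing_polyhedron_one_row[OF A])
  ultimately show ?thesis using A by (auto simp: one_row_closure_def)
qed

section \<open>From the one-row closures to the factor 2\<close>

text \<open>If item \<open>j\<close> alone overfills the row, every nonnegative integral solution
  has entry 0 there, and this passes to the hull. The instance with multiplier 1 suffices.\<close>

lemma aggregation_one_row_bounds:
  assumes A: "A \<in> carrier_mat m n" and i: "i < m" and A0: "\<And>j. j < n \<Longrightarrow> 0 \<le> A $$ (i, j)"
    and x: "x \<in> aggregation_closure (mat_of_rows n [row A i]) (vec_of_list [\<beta>])"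
  shows "row A i \<bullet> x \<le> \<beta>" and "\<And>j. j < n \<Longrightarrow> \<beta> < A $$ (i, j) \<Longrightarrow> x $ j \<le> 0"
proof -
  let ?S = "{y \<in> nonneg_orthant n \<inter> integral_vecs n. row A i \<bullet> y \<le> \<beta>}"
  have c: "x \<in> conv n ?S"
    using x[unfolded aggregation_closure_one_row[OF A], THEN INT_D, of 1] by simp
  have S: "?S \<subseteq> carrier_vec n" by (auto simp: nonneg_orthant_iff)
  show "row A i \<bullet> x \<le> \<beta>" by (rule conv_scalar_prod_le[OF c S]) simp
  fix j assume j: "j < n" "\<beta> < A $$ (i, j)"
  have "unit_vec n j \<bullet> v \<le> 0" if v: "v \<in> ?S" for v
  proof (rule ccontr)
    assume "\<not> ?thesis"
    then have "0 < v $ j" using v j by (auto simp: nonneg_orthant_iff)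
    moreover have "v $ j \<in> \<int>" using v j by (auto simp: integral_vecs_def)
    ultimately have "1 \<le> v $ j" by (elim Ints_cases) simp
    then have "A $$ (i, j) * 1 \<le> A $$ (i, j) * v $ j" using A0 j by (intro mult_left_mono) auto
    also have "\<dots> = row A i $ j * v $ j" using A i j by simp
    also have "\<dots> \<le> (\<Sum>j<n. row A i $ j * v $ j)"
      using v j A i A0 by (intro member_le_sum) (auto simp: nonneg_orthant_iff)
    also have "\<dots> = row A i \<bullet> v" using v S by (subst scalar_prod_sum) auto
    finally show False using v j by auto
  qed
  from conv_scalar_prod_le[OF c S this]
  show "x $ j \<le> 0" using j conv_carrier[OF c] by simp
qed

text \<open>The row implies that coordinate \<open>j\<close> is at most
  \<open>\<beta> / A $$ (i, j)\<close>. For an oversized item this bound lies in [0, 1), so rounding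
  turns it into 0.\<close>

lemma cg_one_row_bounds:
  assumes A: "A \<in> carrier_mat m n" and i: "i < m" and A0: "\<And>j. j < n \<Longrightarrow> 0 \<le> A $$ (i, j)"
    and "0 \<le> \<beta>"
    and x: "x \<in> chvatal_gomory_closure (mat_of_rows n [row A i]) (vec_of_list [\<beta>])"
  shows "row A i \<bullet> x \<le> \<beta>" and "\<And>j. j < n \<Longrightarrow> \<beta> < A $$ (i, j) \<Longrightarrow> x $ j \<le> 0"
proof -
  let ?Q = "{x \<in> nonneg_orthant n. row A i \<bullet> x \<le> \<beta>}"
  have c: "x \<in> cg_closure n ?Q"
    using x by (simp add: chvatal_gomory_closure_def packing_polyhedron_one_row[OF A])
  then have xQ: "x \<in> ?Q" by (simp add: cg_closure_def)
  then show "row A i \<bullet> x \<le> \<beta>" by simp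
  fix j assume j: "j < n" "\<beta> < A $$ (i, j)"
  have v: "unit_vec n j \<bullet> y \<le> \<beta> / A $$ (i, j)" if y: "y \<in> ?Q" for y
  proof -
    have "A $$ (i, j) * y $ j = row A i $ j * y $ j" using A i j by simp
    also have "\<dots> \<le> (\<Sum>j<n. row A i $ j * y $ j)"
      using y j A i A0 by (intro member_le_sum) (auto simp: nonneg_orthant_iff)
    also have "\<dots> = row A i \<bullet> y" using y by (subst scalar_prod_sum) (auto simp: nonneg_orthant_iff)
    also have "\<dots> \<le> \<beta>" using y by simp
    finally show ?thesis using y j \<open>0 \<le> \<beta>\<close> by (simp add: nonneg_orthant_iff field_simps)
  qed
  have "unit_vec n j \<in> integral_vecs n" by (auto simp: integral_vecs_def unit_vec_def)
  then have "unit_vec n j \<bullet> x \<le> of_int \<lfloor>\<beta> / A $$ (i, j)\<rfloor>"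
    using c v unfolding cg_closure_def by blast
  also have "\<lfloor>\<beta> / A $$ (i, j)\<rfloor> = 0" using j \<open>0 \<le> \<beta>\<close> by (simp add: floor_eq_iff)
  finally show "x $ j \<le> 0" using j xQ by (simp add: nonneg_orthant_iff)
qed

text \<open>The one-row bounds supply exactly the hypotheses \<open>le\<close> and
  \<open>supp\<close> under which \<open>x\<close>/2 was placed in the closures.\<close>

lemma half_one_row_closure:
  assumes M: "M = aggregation_closure \<or> M = chvatal_gomory_closure"
    and pd: "packing_data m n A b" and x: "x \<in> one_row_closure M A b"
  shows "(1/2) \<cdot>\<^sub>v x \<in> M A b"
proof -
  have A: "A \<in> carrier_mat m n" and b: "b \<in> carrier_vec m" "\<And>i. i < m \<Longrightarrow> 0 \<le> b $ i"
    and A0: "\<And>i j. i < m \<Longrightarrow> j < n \<Longrightarrow> 0 \<le> A $$ (i, j)"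
    using pd by (auto simp: packing_data_def)
  have x0: "x \<in> nonneg_orthant n"
    and xi: "\<And>i. i < m \<Longrightarrow> x \<in> M (mat_of_rows n [row A i]) (vec_of_list [b $ i])"
    using x A by (auto simp: one_row_closure_def)
  have r: "row A i \<bullet> x \<le> b $ i" "\<And>j. j < n \<Longrightarrow> b $ i < A $$ (i, j) \<Longrightarrow> x $ j \<le> 0"
    if "i < m" for i
    using M xi[OF that] aggregation_one_row_bounds[OF A that A0[OF that]]
      cg_one_row_bounds[OF A that A0[OF that] b(2)[OF that]] by blast+
  have le: "A *\<^sub>v x \<le> b" using A b r by (auto simp: less_eq_vec_def)
  have supp: "A $$ (i, j) \<le> b $ i" if "i < m" "j < n" "x $ j \<noteq> 0" for i j
    using r(2)[of i j] that x0 by (force simp: nonneg_orthant_iff not_less[symmetric])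
  show ?thesis
    using M half_mem_aggregation_closure[OF pd x0 le supp] half_mem_cg_closure[OF pd x0 le supp]
    by blast
qed

text \<open>The objective is compared point by point, which also handles infinite suprema.\<close>

lemma is_approximation_two:
  assumes U: "U \<subseteq> carrier_vec n" and half: "\<And>x. x \<in> U \<Longrightarrow> (1/2) \<cdot>\<^sub>v x \<in> V"
  shows "is_approximation n 2 U V"
  unfolding is_approximation_def
proof (intro ballI SUP_least)
  fix c x assume c: "c \<in> nonneg_orthant n" and x: "x \<in> U"
  have "c \<bullet> ((1/2) \<cdot>\<^sub>v x) = (c \<bullet> x) / 2"
    using c U x by (auto simp: nonneg_orthant_iff)
  then have "ereal (c \<bullet> x) = ereal 2 * ereal (c \<bullet> ((1/2) \<cdot>\<^sub>v x))" by simp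
  also have "\<dots> \<le> ereal 2 * (SUP x\<in>V. ereal (c \<bullet> x))"
    by (intro ereal_mult_left_mono SUP_upper half x) simp
  finally show "ereal (c \<bullet> x) \<le> ereal 2 * (SUP x\<in>V. ereal (c \<bullet> x))" .
qed

section \<open>Tightness of the factor 2\<close>

text \<open>At an integral point \<open>a \<bullet> y\<close> is an integer, so it respects the
  rounded bound; a linear bound then passes to the hull.\<close>

lemma conv_integral_subset_cg_closure:
  assumes Q: "Q \<subseteq> carrier_vec n" and x: "x \<in> conv n (Q \<inter> integral_vecs n)" "x \<in> Q"
  shows "x \<in> cg_closure n Q"
proof -
  have "a \<bullet> x \<le> of_int \<lfloor>\<beta>\<rfloor>"
    if a: "a \<in> integral_vecs n" and v: "\<forall>y\<in>Q. a \<bullet> y \<le> \<beta>" for a and \<beta> :: real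
  proof (rule conv_scalar_prod_le[OF x(1)])
    fix y assume y: "y \<in> Q \<inter> integral_vecs n"
    have "a \<bullet> y = (\<Sum>j<n. a $ j * y $ j)" using y Q by (intro scalar_prod_sum) auto
    also have "\<dots> \<in> \<int>" using a y by (intro Ints_sum Ints_mult) (auto simp: integral_vecs_def)
    finally obtain k where k: "a \<bullet> y = of_int k" by (elim Ints_cases)
    have "a \<bullet> y \<le> \<beta>" using v y by blast
    then show "a \<bullet> y \<le> of_int \<lfloor>\<beta>\<rfloor>" unfolding k by (simp add: le_floor_iff)
  qed (use Q in auto)
  then show ?thesis using x by (auto simp: cg_closure_def)
qed

text \<open>Treats both operators at once: it is enough to lie in the integer hull of each
  row.\<close>

lemma row_hull_subset_one_row_closure:
  assumes M: "M = aggregation_closure \<or> M = chvatal_gomory_closure"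
    and A: "A \<in> carrier_mat m n" and x: "x \<in> nonneg_orthant n"
    and row: "\<And>i. i < m \<Longrightarrow>
      x \<in> conv n ({y \<in> nonneg_orthant n. row A i \<bullet> y \<le> b $ i} \<inter> integral_vecs n)"
  shows "x \<in> one_row_closure M A b"
proof -
  have "x \<in> M (mat_of_rows n [row A i]) (vec_of_list [b $ i])" if i: "i < m" for i
  proof -
    let ?Q = "{y \<in> nonneg_orthant n. row A i \<bullet> y \<le> b $ i}"
    \<comment> \<open>Scaling by a nonnegative \<open>t\<close> can only enlarge the solution set,
      so the hull for the unscaled row is contained in all the others.\<close>
    have "x \<in> conv n {y \<in> nonneg_orthant n \<inter> integral_vecs n. t * (row A i \<bullet> y) \<le> t * b $ i}"
      if "0 \<le> t" for t
      using row[OF i] by (rule conv_mono[THEN subsetD, rotated]) (use that in \<open>auto intro: mult_left_mono\<close>)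
    moreover have "row A i \<bullet> x \<le> b $ i"
      by (rule conv_scalar_prod_le[OF row[OF i]]) (auto simp: nonneg_orthant_iff)
    then have "x \<in> cg_closure n ?Q"
      using x row[OF i] by (intro conv_integral_subset_cg_closure) (auto simp: nonneg_orthant_iff)
    ultimately show ?thesis
      using M by (auto simp: aggregation_closure_one_row[OF A] chvatal_gomory_closure_def
          packing_polyhedron_one_row[OF A])
  qed
  then show ?thesis using A x by (auto simp: one_row_closure_def)
qed

definition tight_mat :: "nat \<Rightarrow> real mat" where
  "tight_mat k = mat 2 2 (\<lambda>(i, j). if i = j then 1 else 1 / real k)"

text \<open>Serves as right-hand side, objective, aggregation multiplier and coefficient vector of
  the cut.\<close>

definition ones :: "real vec" where
  "ones = vec 2 (\<lambda>_. 1)"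

lemma scalar_prod_2: "x \<in> carrier_vec 2 \<Longrightarrow> a \<bullet> x = a $ 0 * x $ 0 + a $ 1 * x $ 1"
  for x a :: "real vec"
  by (simp add: scalar_prod_def numeral_2_eq_2)

lemma packing_data_tight: "packing_data 2 2 (tight_mat k) ones"
  by (auto simp: packing_data_def tight_mat_def ones_def)

lemma tight_row:
  assumes "i < 2" "x \<in> carrier_vec 2"
  shows "row (tight_mat k) i \<bullet> x = x $ i + x $ (1 - i) / k"
  using assms by (auto simp: scalar_prod_2 tight_mat_def less_2_cases_iff)

text \<open>Row \<open>i\<close> admits one copy of item \<open>i\<close> or \<open>k\<close> copies
  of the other item. The weights \<open>k/(k+1)\<close> and \<open>1/(k+1)\<close> on these two
  points give \<open>k/(k+1)\<close> in both coordinates.\<close>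

lemma tight_point:
  assumes k: "0 < k" and M: "M = aggregation_closure \<or> M = chvatal_gomory_closure"
  shows "(real k / (real k + 1)) \<cdot>\<^sub>v ones \<in> one_row_closure M (tight_mat k) ones"
proof (rule row_hull_subset_one_row_closure[OF M, of _ 2 2])
  fix i :: nat assume i: "i < 2"
  let ?S = "{y \<in> nonneg_orthant 2. row (tight_mat k) i \<bullet> y \<le> ones $ i} \<inter> integral_vecs 2"
  let ?K = "\<lambda>j. if j = i then 1 else real k"
  let ?w = "\<lambda>j. if j = i then real k / (real k + 1) else 1 / (real k + 1)"
  have "vec 2 (\<lambda>j. ?w j * ?K j) \<in> conv 2 ?S"
  proof (rule conv_axis_points)
    show "0\<^sub>v 2 \<in> ?S"
      using i by (auto simp: nonneg_orthant_iff integral_vecs_def tight_row ones_def)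
    show "?K j \<cdot>\<^sub>v unit_vec 2 j \<in> ?S" if "j < 2" for j
      using i that k by (auto simp: nonneg_orthant_iff integral_vecs_def tight_row ones_def
          unit_vec_def less_2_cases_iff)
    show "(\<Sum>j<2. ?w j) \<le> 1"
      using i by (auto simp: less_2_cases_iff numeral_2_eq_2 field_simps)
  qed auto
  also have "vec 2 (\<lambda>j. ?w j * ?K j) = (real k / (real k + 1)) \<cdot>\<^sub>v ones"
    by (intro eq_vecI) (auto simp: ones_def)
  finally show "(real k / (real k + 1)) \<cdot>\<^sub>v ones \<in> conv 2 ?S" .
qed (auto simp: tight_mat_def ones_def nonneg_orthant_iff)

text \<open>Adding the two rows gives \<open>(1 + 1/k) (x\<^sub>0 + x\<^sub>1) \<le> 2\<close>, whence \<open>x\<^sub>0 + x\<^sub>1 \<le> 1\<close>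
  after rounding.\<close>

lemma tight_closure_le:
  assumes k: "0 < k" and M: "M = aggregation_closure \<or> M = chvatal_gomory_closure"
    and x: "x \<in> M (tight_mat k) ones"
  shows "ones \<bullet> x \<le> 1"
proof -
  \<comment> \<open>This is 2 divided by \<open>1 + 1/k\<close>. It lies in [1, 2) as
    \<open>k\<close> is at least 1, so its floor is 1.\<close>
  let ?\<beta> = "2 * real k / (real k + 1)"
  have fl: "\<lfloor>?\<beta>\<rfloor> = 1" using k by (auto simp: floor_eq_iff field_simps)
  have T: "tight_mat k \<in> carrier_mat 2 2" by (simp add: tight_mat_def)
  have sum: "ones \<bullet> (tight_mat k *\<^sub>v y) = (1 + 1 / k) * (ones \<bullet> y)" if "y \<in> carrier_vec 2" for y
    using that T tight_row[OF _ that, of 0 k] tight_row[OF _ that, of 1 k]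
    by (subst scalar_prod_2) (auto simp: scalar_prod_2 ones_def field_simps)
  have bnd: "ones \<bullet> y \<le> ?\<beta>" if "y \<in> carrier_vec 2" "ones \<bullet> (tight_mat k *\<^sub>v y) \<le> ones \<bullet> ones" for y
  proof -
    have "ones \<bullet> ones = 2" by (simp add: scalar_prod_2 ones_def)
    then show ?thesis using that k sum by (simp add: field_simps)
  qed
  have on: "ones \<in> nonneg_orthant 2" "ones \<in> carrier_vec 2" "ones \<in> integral_vecs 2"
    by (auto simp: ones_def nonneg_orthant_iff integral_vecs_def)
  from M show ?thesis
  proof
    assume "M = aggregation_closure"
    then have c: "x \<in> conv 2 {y \<in> nonneg_orthant 2 \<inter> integral_vecs 2.
        ones \<bullet> (tight_mat k *\<^sub>v y) \<le> ones \<bullet> ones}"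
      using x T on by (auto simp: aggregation_closure_def)
    show ?thesis
    proof (rule conv_scalar_prod_le[OF c])
      fix y assume y: "y \<in> {y \<in> nonneg_orthant 2 \<inter> integral_vecs 2.
        ones \<bullet> (tight_mat k *\<^sub>v y) \<le> ones \<bullet> ones}"
      then have "ones \<bullet> y \<in> \<int>"
        by (auto simp: scalar_prod_2 ones_def integral_vecs_def)
      then obtain z where z: "ones \<bullet> y = of_int z" by (elim Ints_cases)
      have "ones \<bullet> y \<le> ?\<beta>" using y by (intro bnd) (auto simp: nonneg_orthant_iff)
      then have "z \<le> 1" unfolding z fl[symmetric] by (simp only: le_floor_iff)
      then show "ones \<bullet> y \<le> 1" using z by simp
    qed (auto simp: nonneg_orthant_iff)
  next
    assume M: "M = chvatal_gomory_closure"
    have "ones \<bullet> y \<le> ?\<beta>" if "y \<in> packing_polyhedron (tight_mat k) ones" for y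
      using that T on by (intro bnd scalar_prod_mono[OF on(1)])
        (auto simp: packing_polyhedron_def nonneg_orthant_iff)
    then have "ones \<bullet> x \<le> of_int \<lfloor>?\<beta>\<rfloor>"
      using x[unfolded M chvatal_gomory_closure_def cg_closure_def] T on(3) by auto
    then show ?thesis by (simp add: fl)
  qed
qed

theorem theorem1:
  fixes M :: "real mat \<Rightarrow> real vec \<Rightarrow> real vec set"
  assumes "M = aggregation_closure \<or> M = chvatal_gomory_closure"
  shows "(\<forall>m n A b. packing_data m n A b \<longrightarrow>
            M A b \<subseteq> one_row_closure M A b \<and>
            is_approximation n 2 (one_row_closure M A b) (M A b)) \<and>
         (\<forall>\<epsilon>::real. 0 < \<epsilon> \<longrightarrow>
            (\<exists>m n A b. packing_data m n A b \<and>
               \<not> is_approximation n (2 - \<epsilon>) (one_row_closure M A b) (M A b)))"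
proof (intro conjI allI impI)
  fix m n A b assume pd: "packing_data m n A b"
  show "M A b \<subseteq> one_row_closure M A b"
    using assms aggregation_closure_subset[OF pd] chvatal_gomory_closure_subset[OF pd] by blast
  have "dim_col A = n" using pd by (auto simp: packing_data_def)
  then show "is_approximation n 2 (one_row_closure M A b) (M A b)"
    by (intro is_approximation_two half_one_row_closure[OF assms pd])
      (auto simp: one_row_closure_def nonneg_orthant_iff)
next
  fix \<epsilon> :: real assume e: "0 < \<epsilon>"
  \<comment> \<open>The ratio reached is \<open>2k/(k+1)\<close>, that is 2 -
    \<open>2/(k+1)\<close>, which exceeds 2 - \<epsilon> for such \<open>k\<close>.\<close>
  obtain k :: nat where "2 / \<epsilon> < k" using reals_Archimedean2 by blast
  moreover have "0 < 2 / \<epsilon>" using e by simp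
  ultimately have k: "0 < k" "2 / \<epsilon> < k" by (auto intro: gr0I)
  let ?A = "tight_mat k"
  let ?p = "(real k / (real k + 1)) \<cdot>\<^sub>v ones"
  let ?s = "SUP x\<in>M ?A ones. ereal (ones \<bullet> x)"
  have p: "?p \<in> one_row_closure M ?A ones" by (rule tight_point[OF k(1) assms])
  have cp: "ones \<bullet> ?p = 2 * real k / (real k + 1)"
    by (simp add: scalar_prod_2 ones_def)
  have s1: "?s \<le> 1"
    using tight_closure_le[OF k(1) assms] by (intro SUP_least) simp
  \<comment> \<open>A member of the closure with nonnegative objective value ensures that the
    supremum is at least 0, and so a real number in [0, 1].\<close>
  have half: "(1/2) \<cdot>\<^sub>v ?p \<in> M ?A ones"
    by (rule half_one_row_closure[OF assms packing_data_tight p])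
  have "0 \<le> ones \<bullet> ((1/2) \<cdot>\<^sub>v ?p)" by (simp add: scalar_prod_2 ones_def)
  then have s0: "0 \<le> ?s" by (intro SUP_upper2[OF half]) simp
  have "ereal (2 - \<epsilon>) * ?s < ereal (ones \<bullet> ?p)"
  proof -
    obtain r where r: "?s = ereal r" "0 \<le> r" "r \<le> 1" using s0 s1 by (cases ?s) auto
    \<comment> \<open>For large \<epsilon> the factor is negative and the product is bounded by 0
      instead; the maximum covers both cases.\<close>
    have "(2 - \<epsilon>) * r \<le> max 0 (2 - \<epsilon>)"
      using r mult_left_le[of r "2 - \<epsilon>"] by (cases "2 - \<epsilon> \<ge> 0") (auto simp: max_def mult_nonpos_nonneg)
    also have "\<dots> < 2 * real k / (real k + 1)"
    proof -
      have "2 < k * \<epsilon>" using k e by (simp add: field_simps)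
      then have "2 * (real k + 1) - \<epsilon> * (real k + 1) < 2 * real k" using e by (simp add: algebra_simps)
      then show ?thesis using k by (simp add: field_simps max_def)
    qed
    finally show ?thesis unfolding cp r(1) by simp
  qed
  also have "\<dots> \<le> (SUP x\<in>one_row_closure M ?A ones. ereal (ones \<bullet> x))" by (intro SUP_upper p)
  finally have "\<not> is_approximation 2 (2 - \<epsilon>) (one_row_closure M ?A ones) (M ?A ones)"
    by (auto simp: is_approximation_def not_le nonneg_orthant_iff ones_def intro!: bexI[of _ ones])
  then show "\<exists>m n A b. packing_data m n A b \<and>
      \<not> is_approximation n (2 - \<epsilon>) (one_row_closure M A b) (M A b)"
    using packing_data_tight by blast
qed

end
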